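(* Let $G=(\mathcal{V},\mathcal{E})$, $\tau=\{\tau_i\}_{i\in\mathcal{V}}$, $\alpha^{+}_{f}$, $\mathfrak{I}_{G}$, $G_{t}$, $W^{t}_{\tau}$ and $W_{\tau}$ be as described in the context. Then the limit below exists and $$\lim_{t\to+\infty}\ \sup_{\mathfrak{i}\in\mathfrak{I}_{G}}W^{t}_{\tau}(\mathfrak{i})=\max_{\mathfrak{i}^{c}}W_{\tau}(\mathfrak{i}^{c}),$$ where the maximum is taken over all simple cycles $\mathfrak{i}^{c}=(i^{c}_{0},\ldots,i^{c}_{T(\mathfrak{i}^{c})-1})$ in $G$. Moreover, this maximum satisfies $$\max_{\mathfrak{i}^{c}}W_{\tau}(\mathfrak{i}^{c})\le\sup_{\mathfrak{i}\in G_{t}}W_{\tau}(\mathfrak{i})\quad\text{for any } t\ge 2.$$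
   Context: Setting. $\vartheta$ is a continuous self-map of a complete metric space $\mathcal{Q}$, $\mathbb{T}_{+}=\mathbb{Z}_{\ge 0}$, and $\mathcal{K}\subset\mathcal{Q}$ is a nonempty compact set which is invariant, i.e. $\vartheta^{t}(\mathcal{K})=\mathcal{K}$ for all $t\in\mathbb{T}_{+}$. Let $\mathcal{U}^{1},\ldots,\mathcal{U}^{N}\subset\mathcal{Q}$ be finitely many nonempty sets with $\bigcup_{i=1}^{N}\mathcal{U}^{i}\supset\mathcal{K}$, and fix positive integers $\tau_{1},\ldots,\tau_{N}$ (transition times). Rough symbolic image. $G=(\mathcal{V},\mathcal{E})$ is a directed graph with $\mathcal{V}=\{1,\ldots,N\}$ and $\mathcal{E}\subset\mathcal{V}\times\mathcal{V}$ such that $(i,j)\in\mathcal{E}$ whenever $\vartheta^{\tau_{i}}(\mathcal{U}^{i})\cap\mathcal{U}^{j}\ne\emptyset$ (there may be other edges as well). Proper subadditive family over $(\mathcal{K},\vartheta)$. This is a family $f=\{f^{t}\}_{t\in\mathbb{T}_{+}}$ of functions $f^{t}:\mathcal{K}\to\mathbb{R}\cup\{-\infty\}$ such that: (1) $f^{t+s}(q)\le f^{t}(\vartheta^{s}(q))+f^{s}(q)$ for all $t,s\in\mathbb{T}_{+}$, $q\in\mathcal{K}$; (2) each $f^{t}$ is upper semicontinuous; (3) $\sup_{t\in[0,1]\cap\mathbb{T}_{+}}\sup_{q\in\mathcal{K}}f^{t}(q)<+\infty$. Weights. A proper subadditive family $f$ over $(\mathcal{K},\vartheta)$ is fixed.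 For each $i\in\mathcal{V}$ it is assumed that $f^{\tau_{i}}$ is also defined (extending its values on $\mathcal{K}$) and bounded on $\mathcal{U}^{i}$, and one puts $\alpha^{+}_{f}(i):=\sup_{q\in\mathcal{U}^{i}}f^{\tau_{i}}(q)\in\mathbb{R}$. Paths and relative weights. $\mathfrak{I}_{G}$ is the set of all infinite sequences $\mathfrak{i}=(i_{0},i_{1},\ldots)\in\mathcal{V}^{\mathbb{Z}_{\ge0}}$ with $(i_{s},i_{s+1})\in\mathcal{E}$ for all $s\ge 0$. For $\mathfrak{i}\in\mathfrak{I}_{G}$ and $t\ge1$, $$W^{t}_{\tau}(\mathfrak{i}):=\frac{\sum_{s=0}^{t-1}\alpha^{+}_{f}(i_{s})}{\sum_{s=0}^{t-1}\tau_{i_{s}}}.$$ For $t\ge1$, $G_{t}$ is the set of $t$-tuples $\mathfrak{i}=(i_{0},\ldots,i_{t-1})\in\mathcal{V}^{t}$ with $(i_{s},i_{s+1})\in\mathcal{E}$ for $0\le s\le t-2$ (paths of length $t$), and for $\mathfrak{i}\in G_{t}$ $$W_{\tau}(\mathfrak{i}):=\frac{\sum_{s=0}^{t-1}\alpha^{+}_{f}(i_{s})}{\sum_{s=0}^{t-1}\tau_{i_{s}}}.$$ A cycle of period $T(\mathfrak{i}^{c})=t$ is a tuple $\mathfrak{i}^{c}=(i^{c}_{0},\ldots,i^{c}_{t-1})\in G_{t}$ with $(i^{c}_{t-1},i^{c}_{0})\in\mathcal{E}$; it is simple if its components are pairwise distinct. Self-loops (simple cycles of period $1$, i.e. $(i)$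 with $(i,i)\in\mathcal{E}$) are allowed. For a cycle, $W_{\tau}(\mathfrak{i}^{c})$ is defined by the last formula with $t=T(\mathfrak{i}^{c})$. *)

theory Defs
  imports "HOL-Analysis.Analysis"
begin

text \<open>
  The state space is a type of class \<open>complete_space\<close>; time is \<open>nat\<close>, so \<open>\<theta> ^^ t\<close> is the
  \<open>t\<close>-th iterate of \<open>\<theta>\<close>. Functions with values in the reals extended by minus infinity are
  \<open>ereal\<close>-valued functions avoiding \<open>\<infinity>\<close>.
\<close>

definition invariant_set :: "('a \<Rightarrow> 'a) \<Rightarrow> 'a set \<Rightarrow> bool" where
  "invariant_set \<theta> K \<longleftrightarrow> (\<forall>t. (\<theta> ^^ t) ` K = K)"

definition upper_semicontinuous_on :: "'a::topological_space set \<Rightarrow> ('a \<Rightarrow> ereal) \<Rightarrow> bool" where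
  "upper_semicontinuous_on S g \<longleftrightarrow>
     (\<forall>x\<in>S. \<forall>c. g x < c \<longrightarrow> (\<forall>\<^sub>F y in at x within S. g y < c))"

text \<open>
  Only the values \<open>f t q\<close> with \<open>q \<in> K\<close> are constrained. Values off \<open>K\<close> serve to represent
  extensions of \<open>f t\<close> to larger sets.
\<close>

definition proper_subadditive_family ::
    "'a::topological_space set \<Rightarrow> ('a \<Rightarrow> 'a) \<Rightarrow> (nat \<Rightarrow> 'a \<Rightarrow> ereal) \<Rightarrow> bool" where
  "proper_subadditive_family K \<theta> f \<longleftrightarrow>
     (\<forall>t. \<forall>q\<in>K. f t q \<noteq> \<infinity>) \<and>
     (\<forall>t s. \<forall>q\<in>K. f (t + s) q \<le> f t ((\<theta> ^^ s) q) + f s q) \<and>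
     (\<forall>t. upper_semicontinuous_on K (f t)) \<and>
     (SUP t\<in>{0..1}. SUP q\<in>K. f t q) < \<infinity>"

definition rough_symbolic_image ::
    "('a \<Rightarrow> 'a) \<Rightarrow> nat set \<Rightarrow> (nat \<Rightarrow> 'a set) \<Rightarrow> (nat \<Rightarrow> nat) \<Rightarrow> (nat \<times> nat) set \<Rightarrow> bool" where
  "rough_symbolic_image \<theta> V U \<tau> E \<longleftrightarrow>
     E \<subseteq> V \<times> V \<and>
     (\<forall>i\<in>V. \<forall>j\<in>V. (\<theta> ^^ \<tau> i) ` U i \<inter> U j \<noteq> {} \<longrightarrow> (i, j) \<in> E)"

text \<open>The supremum is taken in \<open>ereal\<close>; the conversion is meaningful when it is finite.\<close>

definition alpha_plus ::
    "(nat \<Rightarrow> 'a \<Rightarrow> ereal) \<Rightarrow> (nat \<Rightarrow> 'a set) \<Rightarrow> (nat \<Rightarrow> nat) \<Rightarrow> nat \<Rightarrow> real" where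
  "alpha_plus f U \<tau> i = real_of_ereal (SUP q\<in>U i. f (\<tau> i) q)"

definition infinite_paths :: "nat set \<Rightarrow> (nat \<times> nat) set \<Rightarrow> (nat \<Rightarrow> nat) set" where
  "infinite_paths V E = {p. (\<forall>s. p s \<in> V) \<and> (\<forall>s. (p s, p (Suc s)) \<in> E)}"

definition paths_of_length :: "nat set \<Rightarrow> (nat \<times> nat) set \<Rightarrow> nat \<Rightarrow> nat list set" where
  "paths_of_length V E t =
     {p. length p = t \<and> set p \<subseteq> V \<and> (\<forall>s. Suc s < t \<longrightarrow> (p ! s, p ! Suc s) \<in> E)}"

definition cycles :: "nat set \<Rightarrow> (nat \<times> nat) set \<Rightarrow> nat list set" where
  "cycles V E = {p. \<exists>t\<ge>1. p \<in> paths_of_length V E t \<and> (last p, hd p) \<in> E}"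

definition simple_cycles :: "nat set \<Rightarrow> (nat \<times> nat) set \<Rightarrow> nat list set" where
  "simple_cycles V E = {p \<in> cycles V E. distinct p}"

definition relative_weight_upto ::
    "(nat \<Rightarrow> real) \<Rightarrow> (nat \<Rightarrow> nat) \<Rightarrow> nat \<Rightarrow> (nat \<Rightarrow> nat) \<Rightarrow> real" where
  "relative_weight_upto \<alpha> \<tau> t p = (\<Sum>s<t. \<alpha> (p s)) / (\<Sum>s<t. real (\<tau> (p s)))"

definition relative_weight ::
    "(nat \<Rightarrow> real) \<Rightarrow> (nat \<Rightarrow> nat) \<Rightarrow> nat list \<Rightarrow> real" where
  "relative_weight \<alpha> \<tau> p =
     (\<Sum>s<length p. \<alpha> (p ! s)) / (\<Sum>s<length p. real (\<tau> (p ! s)))"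

end

theory Submission
  imports Defs
begin

text \<open>
  Let \<open>M\<close> be the maximal relative weight of a simple cycle and put \<open>\<beta> i = \<alpha> i - M * \<tau> i\<close>, so that
  simple cycles have nonpositive \<open>\<beta>\<close>-sum and some simple cycle \<open>c\<close> has \<open>\<beta>\<close>-sum zero. Cutting simple
  cycles out of a path leaves a path without repeated vertices, so the \<open>\<beta>\<close>-sum of any path is at most
  a constant, and paths of length \<open>t\<close> have relative weight at most \<open>M + O(1/t)\<close>. Conversely, the
  \<open>\<beta>\<close>-sums over windows of length \<open>t\<close> of the periodic path around \<open>c\<close> average to zero over the
  starting points, so some window has relative weight at least \<open>M\<close>. Simple cycles exist because
  the orbit of a point of \<open>K\<close> produces an infinite path.
\<close>

section \<open>Paths and cycles as lists\<close>

text \<open>\<open>successively\<close> splits over \<open>@\<close>, so lists can be cut and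
  spliced without index arithmetic.\<close>

lemma paths_of_length_iff:
  "p \<in> paths_of_length V E t \<longleftrightarrow>
     length p = t \<and> set p \<subseteq> V \<and> successively (\<lambda>x y. (x, y) \<in> E) p"
  by (auto simp: paths_of_length_def successively_conv_nth)

lemma cycles_iff:
  "p \<in> cycles V E \<longleftrightarrow>
     p \<noteq> [] \<and> set p \<subseteq> V \<and> successively (\<lambda>x y. (x, y) \<in> E) p \<and> (last p, hd p) \<in> E"
  by (auto simp: cycles_def paths_of_length_iff Suc_le_eq)

lemma sum_nth_eq_sum_list: "(\<Sum>s<length p. g (p ! s)) = sum_list (map g p)"
  by (simp add: sum_list_sum_nth atLeast0LessThan)

lemma finite_simple_cycles:
  assumes "finite V"
  shows "finite (simple_cycles V E)"
proof (rule finite_subset)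
  show "simple_cycles V E \<subseteq> {p. set p \<subseteq> V \<and> length p \<le> card V}"
    using assms by (auto simp: simple_cycles_def cycles_iff)
      (metis card_mono distinct_card)
  show "finite {p. set p \<subseteq> V \<and> length p \<le> card V}"
    by (rule finite_lists_length_le[OF assms])
qed

lemma finite_paths_of_length:
  assumes "finite V"
  shows "finite (paths_of_length V E t)"
  by (rule finite_subset[OF _ finite_lists_length_eq[OF assms, of t]])
    (auto simp: paths_of_length_iff)

lemma map_infinite_path:
  assumes "p \<in> infinite_paths V E"
  shows "map p [0..<t] \<in> paths_of_length V E t"
  using assms by (auto simp: infinite_paths_def paths_of_length_def)

lemma relative_weight_upto_eq:
  "relative_weight_upto \<alpha> \<tau> t p = relative_weight \<alpha> \<tau> (map p [0..<t])"
  by (simp add: relative_weight_upto_def relative_weight_def)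

section \<open>Bounding sums by cutting out cycles\<close>

text \<open>A repeated vertex \<open>y\<close> splits a cycle into two strictly shorter cycles
  through \<open>y\<close> whose sums add up to the original one; iterating ends in simple
  cycles.\<close>

lemma cycle_sum_nonpos:
  fixes \<beta> :: "nat \<Rightarrow> real"
  assumes simple: "\<And>c. c \<in> simple_cycles V E \<Longrightarrow> sum_list (map \<beta> c) \<le> 0"
    and "p \<in> cycles V E"
  shows "sum_list (map \<beta> p) \<le> 0"
  using assms(2)
proof (induction p rule: measure_induct_rule[where f = length])
  case (less p)
  show ?case
  proof (cases "distinct p")
    case True
    then show ?thesis using less.prems simple by (auto simp: simple_cycles_def)
  next
    case False
    then obtain xs ys zs y where p: "p = xs @ [y] @ ys @ [y] @ zs"
      using not_distinct_decomp by blast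
    have "y # ys \<in> cycles V E" "xs @ y # zs \<in> cycles V E"
      using \<open>p \<in> cycles V E\<close> unfolding p cycles_iff
      by (auto simp: successively_append_iff successively_Cons hd_append split: if_splits)
    then have "sum_list (map \<beta> (y # ys)) \<le> 0" "sum_list (map \<beta> (xs @ y # zs)) \<le> 0"
      using less.IH[of "y # ys"] less.IH[of "xs @ y # zs"] p by auto
    then show ?thesis by (simp add: p)
  qed
qed

text \<open>Cutting a cycle out of a path does not lower the sum, and a path without repetitions
  visits each vertex at most once. The bound is independent of \<open>t\<close>, which later gives
  an error of order \<open>1/t\<close>.\<close>

lemma path_sum_bounded:
  fixes \<beta> :: "nat \<Rightarrow> real"
  assumes "finite V"
    and simple: "\<And>c. c \<in> simple_cycles V E \<Longrightarrow> sum_list (map \<beta> c) \<le> 0"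
    and "p \<in> paths_of_length V E t"
  shows "sum_list (map \<beta> p) \<le> (\<Sum>i\<in>V. \<bar>\<beta> i\<bar>)"
  using assms(3)
proof (induction p arbitrary: t rule: measure_induct_rule[where f = length])
  case (less p)
  have V: "set p \<subseteq> V" using less.prems by (simp add: paths_of_length_iff)
  show ?case
  proof (cases "distinct p")
    case True
    then have "sum_list (map \<beta> p) = (\<Sum>i\<in>set p. \<beta> i)"
      by (simp add: sum_list_distinct_conv_sum_set)
    also have "\<dots> \<le> (\<Sum>i\<in>set p. \<bar>\<beta> i\<bar>)" by (intro sum_mono) auto
    also have "\<dots> \<le> (\<Sum>i\<in>V. \<bar>\<beta> i\<bar>)" using V \<open>finite V\<close> by (intro sum_mono2) auto
    finally show ?thesis .
  next
    case False
    then obtain xs ys zs y where p: "p = xs @ [y] @ ys @ [y] @ zs"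
      using not_distinct_decomp by blast
    have cyc: "y # ys \<in> cycles V E"
      and path: "xs @ y # zs \<in> paths_of_length V E (length (xs @ y # zs))"
      using less.prems unfolding p cycles_iff paths_of_length_iff
      by (auto simp: successively_append_iff successively_Cons split: if_splits)
    have "sum_list (map \<beta> (y # ys)) \<le> 0"
      by (rule cycle_sum_nonpos[OF simple cyc])
    moreover have "sum_list (map \<beta> (xs @ y # zs)) \<le> (\<Sum>i\<in>V. \<bar>\<beta> i\<bar>)"
      using less.IH[OF _ path] p by simp
    ultimately show ?thesis by (simp add: p)
  qed
qed

text \<open>Pigeonhole in disguise: without simple cycles the previous bound applies to the constant
  weight 1, so no path could have more than \<open>card V\<close> vertices.\<close>

lemma simple_cycles_nonempty:
  assumes "finite V" and "p \<in> infinite_paths V E"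
  shows "simple_cycles V E \<noteq> {}"
proof
  assume "simple_cycles V E = {}"
  then have "sum_list (map (\<lambda>_. 1) (map p [0..<Suc (card V)])) \<le> (\<Sum>i\<in>V. \<bar>1::real\<bar>)"
    by (intro path_sum_bounded[OF assms(1) _ map_infinite_path[OF assms(2)]]) simp
  then show False by (simp add: sum_list_triv)
qed

section \<open>Windows of a periodic path\<close>

lemma sum_periodic_shift:
  fixes g :: "nat \<Rightarrow> real"
  assumes "\<And>k. g (k + T) = g k"
  shows "(\<Sum>k<T. g (k + s)) = (\<Sum>k<T. g k)"
proof (induction s)
  case (Suc s)
  \<comment> \<open>A window of \<open>Suc T\<close> terms is split off at its first and then at its
    last term; these two agree by periodicity.\<close>
  have "g s + (\<Sum>k<T. g (k + Suc s)) = (\<Sum>k<Suc T. g (k + s))"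
    by (subst sum.lessThan_Suc_shift) simp
  also have "\<dots> = (\<Sum>k<T. g (k + s)) + g s"
    using assms[of s] by (simp add: add.commute)
  finally show ?case using Suc by simp
qed simp

text \<open>Since \<open>t\<close> need not be a multiple of the period, the starting point on the
  cycle must be chosen; averaging over all starting points shows that a good one exists.\<close>

lemma cycle_window_nonneg:
  fixes \<beta> :: "nat \<Rightarrow> real"
  assumes c: "c \<in> cycles V E" and zero: "sum_list (map \<beta> c) = 0"
  shows "\<exists>p\<in>infinite_paths V E. (\<Sum>s<t. \<beta> (p s)) \<ge> 0"
proof -
  define T where "T = length c"
  define p where "p k = c ! (k mod T)" for k
  have "T > 0" using c by (auto simp: T_def cycles_iff)
  have "p k \<in> V" for k
    using c \<open>T > 0\<close> by (auto simp: p_def T_def cycles_iff)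
  moreover have "(p k, p (Suc k)) \<in> E" for k
  \<comment> \<open>The wrap-around uses the closing edge of \<open>c\<close>; all other steps use
    inner edges.\<close>
  proof (cases "Suc (k mod T) = T")
    case True
    then have "k mod T = T - 1" "Suc k mod T = 0" by (simp_all add: mod_Suc)
    then have "p k = last c" "p (Suc k) = hd c"
      using \<open>T > 0\<close> by (simp_all add: p_def T_def last_conv_nth hd_conv_nth)
    then show ?thesis using c by (simp add: cycles_iff)
  next
    case False
    then have "Suc (k mod T) < length c"
      using \<open>T > 0\<close> mod_less_divisor[of T k] unfolding T_def by linarith
    then show ?thesis
      using c False by (simp add: p_def mod_Suc cycles_iff successively_conv_nth)
  qed
  ultimately have path: "(\<lambda>s. p (k + s)) \<in> infinite_paths V E" for k
    by (simp add: infinite_paths_def)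
  have "(\<Sum>k<T. \<beta> (p (k + s))) = 0" for s
  proof -
    have "(\<Sum>k<T. \<beta> (p (k + s))) = (\<Sum>k<T. \<beta> (p k))"
      by (rule sum_periodic_shift) (simp add: p_def)
    also have "\<dots> = (\<Sum>k<T. \<beta> (c ! k))" by (simp add: p_def)
    finally show ?thesis using zero by (simp add: T_def sum_nth_eq_sum_list)
  qed
  \<comment> \<open>After exchanging the sums, each offset \<open>s\<close> contributes a full
    period, hence zero. So the \<open>T\<close> window sums cannot all be negative.\<close>
  then have "(\<Sum>k<T. \<Sum>s<t. \<beta> (p (k + s))) = 0"
    by (subst sum.swap) simp
  then have "\<exists>k<T. (\<Sum>s<t. \<beta> (p (k + s))) \<ge> 0"
    using sum_strict_mono[of "{..<T}" "\<lambda>k. \<Sum>s<t. \<beta> (p (k + s))" "\<lambda>_. 0"] \<open>T > 0\<close>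
    by fastforce
  then obtain k where "(\<Sum>s<t. \<beta> (p (k + s))) \<ge> 0" by blast
  then show ?thesis using path[of k] by (rule bexI)
qed

section \<open>Relative weights compared with the maximum\<close>

text \<open>The sign of the \<beta>-sum decides on which side of \<open>M\<close> the weight lies,
  and the length bound on the denominator turns a bounded \<beta>-sum into a small
  deviation.\<close>

lemma relative_weight_excess:
  assumes "\<And>i. i \<in> set p \<Longrightarrow> \<tau> i \<ge> 1" and "p \<noteq> []"
  shows "relative_weight \<alpha> \<tau> p =
    M + sum_list (map (\<lambda>i. \<alpha> i - M * real (\<tau> i)) p) / sum_list (map (\<lambda>i. real (\<tau> i)) p)"
    and "sum_list (map (\<lambda>i. real (\<tau> i)) p) \<ge> real (length p)"
proof -
  have "sum_list (map (\<lambda>_. 1) p) \<le> sum_list (map (\<lambda>i. real (\<tau> i)) p)"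
    by (rule sum_list_mono) (use assms(1) in auto)
  then show len: "sum_list (map (\<lambda>i. real (\<tau> i)) p) \<ge> real (length p)"
    by (simp add: sum_list_triv)
  have "sum_list (map (\<lambda>i. real (\<tau> i)) p) \<noteq> 0"
    using len \<open>p \<noteq> []\<close> by (cases p) auto
  moreover have "sum_list (map (\<lambda>i. \<alpha> i - M * real (\<tau> i)) p) =
      sum_list (map \<alpha> p) - M * sum_list (map (\<lambda>i. real (\<tau> i)) p)"
    by (simp add: sum_list_subtractf sum_list_const_mult)
  ultimately show "relative_weight \<alpha> \<tau> p =
    M + sum_list (map (\<lambda>i. \<alpha> i - M * real (\<tau> i)) p) / sum_list (map (\<lambda>i. real (\<tau> i)) p)"
    by (simp add: relative_weight_def sum_nth_eq_sum_list sum_nth_eq_sum_list[of "\<lambda>i. real (\<tau> i)"]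
        diff_divide_distrib)
qed

lemma max_mean_cycle:
  fixes V :: "nat set" and E :: "(nat \<times> nat) set" and \<alpha> :: "nat \<Rightarrow> real" and \<tau> :: "nat \<Rightarrow> nat"
  defines "M \<equiv> Max (relative_weight \<alpha> \<tau> ` simple_cycles V E)"
  assumes V: "finite V" and \<tau>: "\<And>i. i \<in> V \<Longrightarrow> \<tau> i \<ge> 1" and "simple_cycles V E \<noteq> {}"
  shows "(\<lambda>t. SUP p\<in>infinite_paths V E. relative_weight_upto \<alpha> \<tau> t p) \<longlonglongrightarrow> M"
    and "t \<ge> 1 \<Longrightarrow> M \<le> (SUP p\<in>paths_of_length V E t. relative_weight \<alpha> \<tau> p)"
proof -
  let ?W = "relative_weight \<alpha> \<tau>"
  define \<beta> where "\<beta> i = \<alpha> i - M * real (\<tau> i)" for i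
  define C where "C = (\<Sum>i\<in>V. \<bar>\<beta> i\<bar>)"
  have fin: "finite (?W ` simple_cycles V E)" and ne: "?W ` simple_cycles V E \<noteq> {}"
    using assms finite_simple_cycles by auto
  have weight: "?W p = M + sum_list (map \<beta> p) / sum_list (map (\<lambda>i. real (\<tau> i)) p)"
    and len: "sum_list (map (\<lambda>i. real (\<tau> i)) p) \<ge> real (length p)"
    if "set p \<subseteq> V" "p \<noteq> []" for p
    using relative_weight_excess(1)[of p \<tau> \<alpha> M] relative_weight_excess(2)[of p \<tau>] that \<tau>
    unfolding \<beta>_def by blast+
  have pos: "sum_list (map (\<lambda>i. real (\<tau> i)) p) > 0" if "set p \<subseteq> V" "p \<noteq> []" for p
    using len[OF that] \<open>p \<noteq> []\<close> by (cases p) auto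
  have nonpos: "sum_list (map \<beta> c) \<le> 0" if c: "c \<in> simple_cycles V E" for c
  proof -
    have "set c \<subseteq> V" "c \<noteq> []" using c by (auto simp: simple_cycles_def cycles_iff)
    moreover have "?W c \<le> M" using c fin by (simp add: M_def)
    ultimately show ?thesis using weight[of c] pos[of c] by (simp add: divide_le_0_iff)
  qed
  have upper: "?W p \<le> M + C / real t" if p: "p \<in> paths_of_length V E t" and "t \<ge> 1" for p t
  proof -
    have *: "set p \<subseteq> V" "p \<noteq> []" "length p = t" using that by (auto simp: paths_of_length_iff)
    have "sum_list (map \<beta> p) \<le> C"
      unfolding C_def by (rule path_sum_bounded[OF V nonpos p])
    \<comment> \<open>Nonnegativity of \<open>C\<close> allows the denominator to be lowered to
      \<open>t\<close> even if the \<beta>-sum is negative.\<close>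
    moreover have "C \<ge> 0" by (simp add: C_def sum_nonneg)
    ultimately have "sum_list (map \<beta> p) / sum_list (map (\<lambda>i. real (\<tau> i)) p) \<le> C / real t"
      using len[OF *(1,2)] * \<open>t \<ge> 1\<close> by (intro frac_le) auto
    then show ?thesis using weight[OF *(1,2)] by simp
  qed
  \<comment> \<open>A cycle attaining the maximum has excess exactly zero, as the averaging argument
    requires.\<close>
  obtain c where c: "c \<in> simple_cycles V E" "M = ?W c"
    using Max_in[OF fin ne] unfolding M_def by auto
  then have cyc: "c \<in> cycles V E" by (simp add: simple_cycles_def)
  have zero: "sum_list (map \<beta> c) = 0"
    using weight[of c] pos[of c] c cyc by (auto simp: cycles_iff)
  have lower: "\<exists>p\<in>infinite_paths V E. M \<le> ?W (map p [0..<t])" if "t \<ge> 1" for t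
  proof -
    obtain p where p: "p \<in> infinite_paths V E" "(\<Sum>s<t. \<beta> (p s)) \<ge> 0"
      using cycle_window_nonneg[OF cyc zero] by blast
    have "set (map p [0..<t]) \<subseteq> V" "map p [0..<t] \<noteq> []"
      using p(1) \<open>t \<ge> 1\<close> by (auto simp: infinite_paths_def)
    moreover have "sum_list (map \<beta> (map p [0..<t])) \<ge> 0"
      using p(2) by (simp add: sum_list_sum_nth atLeast0LessThan)
    ultimately have "?W (map p [0..<t]) \<ge> M"
      using weight[of "map p [0..<t]"] pos[of "map p [0..<t]"] by (simp add: zero_le_divide_iff)
    then show ?thesis using p by blast
  qed
  have sup_le: "(SUP p\<in>infinite_paths V E. relative_weight_upto \<alpha> \<tau> t p) \<le> M + C / real t"
    and sup_ge: "M \<le> (SUP p\<in>infinite_paths V E. relative_weight_upto \<alpha> \<tau> t p)"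
    if t: "t \<ge> 1" for t
  proof -
    \<comment> \<open>This bound also makes the real-valued supremum dominate its members.\<close>
    have bd: "relative_weight_upto \<alpha> \<tau> t p \<le> M + C / real t" if "p \<in> infinite_paths V E" for p
      using upper[OF map_infinite_path[OF that] t] by (simp add: relative_weight_upto_eq)
    obtain p where p: "p \<in> infinite_paths V E" "M \<le> relative_weight_upto \<alpha> \<tau> t p"
      using lower[OF t] by (auto simp: relative_weight_upto_eq)
    show "(SUP p\<in>infinite_paths V E. relative_weight_upto \<alpha> \<tau> t p) \<le> M + C / real t"
      using p bd by (intro cSUP_least) auto
    show "M \<le> (SUP p\<in>infinite_paths V E. relative_weight_upto \<alpha> \<tau> t p)"
      using p bd by (intro cSUP_upper2[OF _ p(1)] bdd_aboveI2) auto
  qed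
  have lim: "(\<lambda>t. M + C / real t) \<longlonglongrightarrow> M"
    using tendsto_add[OF tendsto_const[of M] lim_const_over_n[of C]] by simp
  show "(\<lambda>t. SUP p\<in>infinite_paths V E. relative_weight_upto \<alpha> \<tau> t p) \<longlonglongrightarrow> M"
    \<comment> \<open>The estimates start at \<open>t = 1\<close>; at \<open>t = 0\<close> the
      weight is \<open>0/0\<close>, which is 0 by convention.\<close>
    by (rule tendsto_sandwich[OF _ _ tendsto_const lim]; rule eventually_sequentiallyI[of 1])
      (auto intro: sup_ge sup_le)
  show "M \<le> (SUP p\<in>paths_of_length V E t. ?W p)" if "t \<ge> 1"
  proof -
    obtain p where p: "p \<in> infinite_paths V E" "M \<le> ?W (map p [0..<t])"
      using lower \<open>t \<ge> 1\<close> by blast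
    show ?thesis
      using p map_infinite_path[OF p(1)] finite_paths_of_length[OF V]
      by (intro cSUP_upper2[of _ _ "map p [0..<t]"] bdd_above_finite) auto
  qed
qed

section \<open>Infinite paths from orbits\<close>

lemma infinite_path_exists:
  assumes "K \<noteq> {}" and "invariant_set \<theta> K" and cover: "K \<subseteq> (\<Union>i\<in>V. U i)"
    and rsi: "rough_symbolic_image \<theta> V U \<tau> E"
  shows "infinite_paths V E \<noteq> {}"
proof -
  \<comment> \<open>Vertices whose sets meet \<open>K\<close> always have a successor of the same
    kind: a point of \<open>K\<close> in \<open>U i\<close> is mapped into \<open>K\<close> by
    invariance, hence into some covering set. Dependent choice then builds the path.\<close>
  define X where "X = {i\<in>V. U i \<inter> K \<noteq> {}}"
  have "\<exists>j\<in>X. (i, j) \<in> E" if "i \<in> X" for i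
  proof -
    obtain q where q: "q \<in> U i" "q \<in> K" using \<open>i \<in> X\<close> by (auto simp: X_def)
    then have "(\<theta> ^^ \<tau> i) q \<in> K" using \<open>invariant_set \<theta> K\<close> by (auto simp: invariant_set_def)
    then obtain j where "j \<in> V" "(\<theta> ^^ \<tau> i) q \<in> U j" using cover by blast
    then show ?thesis
      using q \<open>i \<in> X\<close> \<open>(\<theta> ^^ \<tau> i) q \<in> K\<close> rsi
      unfolding X_def rough_symbolic_image_def by blast
  qed
  moreover have "\<exists>i. i \<in> X" using \<open>K \<noteq> {}\<close> cover by (auto simp: X_def)
  ultimately obtain p where "\<And>s::nat. p s \<in> X \<and> (p s, p (Suc s)) \<in> E"
    using dependent_nat_choice[of "\<lambda>_ i. i \<in> X" "\<lambda>_ i j. (i, j) \<in> E"] by blast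
  then have "p \<in> infinite_paths V E" by (auto simp: infinite_paths_def X_def)
  then show ?thesis by blast
qed

theorem proposition4p2:
  fixes \<theta> :: "'a::complete_space \<Rightarrow> 'a"
    and K :: "'a set"
    and N :: nat
    and V :: "nat set"
    and U :: "nat \<Rightarrow> 'a set"
    and \<tau> :: "nat \<Rightarrow> nat"
    and E :: "(nat \<times> nat) set"
    and f :: "nat \<Rightarrow> 'a \<Rightarrow> ereal"
    and \<alpha> :: "nat \<Rightarrow> real"
  assumes "continuous_on UNIV \<theta>"
    and "compact K" and "K \<noteq> {}" and "invariant_set \<theta> K"
    and V: "V = {1..N}"
    and "\<And>i. i \<in> V \<Longrightarrow> U i \<noteq> {}"
    and "K \<subseteq> (\<Union>i\<in>V. U i)"
    and "\<And>i. i \<in> V \<Longrightarrow> \<tau> i \<ge> 1"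
    and "rough_symbolic_image \<theta> V U \<tau> E"
    and "proper_subadditive_family K \<theta> f"
    and bounded: "\<And>i. i \<in> V \<Longrightarrow> \<exists>C::real. \<forall>q\<in>U i. f (\<tau> i) q \<le> ereal C"
    and sup_real: "\<And>i. i \<in> V \<Longrightarrow> (SUP q\<in>U i. f (\<tau> i) q) \<noteq> -\<infinity>"
    and \<alpha>: "\<alpha> = alpha_plus f U \<tau>"
  shows "finite (simple_cycles V E) \<and> simple_cycles V E \<noteq> {} \<and>
    (\<lambda>t. SUP p\<in>infinite_paths V E. relative_weight_upto \<alpha> \<tau> t p)
       \<longlonglongrightarrow> Max (relative_weight \<alpha> \<tau> ` simple_cycles V E) \<and>
    (\<forall>t\<ge>2. Max (relative_weight \<alpha> \<tau> ` simple_cycles V E)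
       \<le> (SUP p\<in>paths_of_length V E t. relative_weight \<alpha> \<tau> p))"
proof -
  have V_fin: "finite V" using V by simp
  have ne: "simple_cycles V E \<noteq> {}"
    using infinite_path_exists[OF assms(3,4,7,9)] simple_cycles_nonempty[OF V_fin] by blast
  show ?thesis
    using finite_simple_cycles[OF V_fin] ne max_mean_cycle[OF V_fin assms(8) ne] by simp
qed

end
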